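(* Let $\Theta$ be an irrational real $r\times s$ matrix. The following are equivalent: (a) $\Theta$ is badly approximable; (b) ${\rm Spec}(\Theta)=\{(\mu,\nu)\in\mathbb P_\varepsilon^2:\mu<\nu\}$; (c) ${\rm Spec}_{\rm flat}(\Theta)=\emptyset$.
   Context: Fix a nonprincipal ultrafilter $\mathfrak u$ on $\mathbb N$, and let ${}^*\mathbb Z\subset{}^*\mathbb R$ be the ultrapowers of $\mathbb Z\subset\mathbb R$. Let ${}^*\mathbb R_{\rm fin}$ be the ring of bounded elements, ${}^*\mathbb R_\varepsilon$ its ideal of infinitesimals, and $({}^*\mathbb R_{\rm fin})^\times_+$ the multiplicative group of positive elements that are neither infinite nor infinitesimal. Let $\mathbb P:=({}^*\mathbb R_{>0}\cup\{0\})/({}^*\mathbb R_{\rm fin})^\times_+$; write $\langle x\rangle\in\mathbb P$ for the class of $|x|$, and $-\infty:=\langle0\rangle$. $\mathbb P$ has the induced product, real powers $\langle x\rangle^t=\langle |x|^t\rangle$ ($t>0$), and total order ($\mu<\mu'$ iff $x<x'$ for all representatives; $-\infty$ is the minimum). $\mathbb P_\varepsilon\subset\mathbb P$ is the set of classes of positive infinitesimals. For a vector $v\in{}^*\mathbb R^k$ let $\overline{|v|}:=\max_j|v_j|$. For a real $r\times s$ matrix $\Theta$, ${}^*\mathbb Z^s(\Theta)$ is the group of $n\in{}^*\mathbb Z^s$ for which there is a (unique) $n^\perp\in{}^*\mathbb Z^r$ with $\varepsilon(n):=\Theta n-n^\perp\in{}^*\mathbb R_\varepsilon^r$. For $\mu,\nu\in\mathbb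 P_\varepsilon$, $$({}^*\mathbb Z^s)^{\mu}_\nu(\Theta):=\{0\ne n\in{}^*\mathbb Z^s(\Theta):\ \langle\overline{|n|}\rangle^{-1}>\mu^{1/s},\ \langle\overline{|\varepsilon(n)|}\rangle\le\nu^{1/r}\}\cup\{0\}.$$ ${\rm Spec}(\Theta):=\{(\mu,\nu)\in\mathbb P_\varepsilon^2:({}^*\mathbb Z^s)^\mu_\nu(\Theta)\ne0\}$ and ${\rm Spec}_{\rm flat}(\Theta)$ is its intersection with the diagonal $\mu=\nu$. $\Theta$ is rational if there is a nonzero $m\in\mathbb Z^s$ with $\Theta m\in\mathbb Z^r$, and irrational otherwise. $\Theta$ is badly approximable if there is a real constant $C>0$ such that $\overline{|n|}^{\,s}\cdot\overline{|\varepsilon(n)|}^{\,r}>C$ for all nonzero $n\in{}^*\mathbb Z^s(\Theta)$. *)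

theory Defs
  imports "HOL-Analysis.Analysis" "HOL-Algebra.Ring"
begin

definition nonprincipal_ultrafilter :: "'a filter \<Rightarrow> bool" where
  "nonprincipal_ultrafilter U \<longleftrightarrow>
     U \<noteq> bot \<and> (\<forall>P. eventually P U \<or> eventually (\<lambda>i. \<not> P i) U) \<and> (\<forall>a. U \<noteq> principal {a})"

text \<open>
  The ultrafilter is a parameter, so the ultrapower cannot be a type. A hyperreal is an
  equivalence class of real sequences, and an element of \<open>*\<real>\<^sup>k\<close> is a vector of such classes.
\<close>

type_synonym hyp =  "(nat \<Rightarrow> real) set"

definition ultra_rel :: "nat filter \<Rightarrow> (nat \<Rightarrow> real) rel" where
  "ultra_rel U = {(X, Y). \<forall>\<^sub>F i in U. X i = Y i}"

definition ultra_class :: "nat filter \<Rightarrow> (nat \<Rightarrow> real) \<Rightarrow> hyp" where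
  "ultra_class U X = ultra_rel U `` {X}"

definition hconst :: "nat filter \<Rightarrow> real \<Rightarrow> hyp" where
  "hconst U c = ultra_class U (\<lambda>_. c)"

definition hlift :: "nat filter \<Rightarrow> (real \<Rightarrow> real) \<Rightarrow> hyp \<Rightarrow> hyp" where
  "hlift U f x = (\<Union>X\<in>x. ultra_class U (\<lambda>i. f (X i)))"

definition hlift2 :: "nat filter \<Rightarrow> (real \<Rightarrow> real \<Rightarrow> real) \<Rightarrow> hyp \<Rightarrow> hyp \<Rightarrow> hyp" where
  "hlift2 U f x y = (\<Union>X\<in>x. \<Union>Y\<in>y. ultra_class U (\<lambda>i. f (X i) (Y i)))"

definition hyperreal :: "nat filter \<Rightarrow> hyp ring" where
  "hyperreal U =
     \<lparr>carrier = UNIV // ultra_rel U,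
      mult = hlift2 U (*), one = hconst U 1,
      zero = hconst U 0, add = hlift2 U (+)\<rparr>"

definition hyperint :: "nat filter \<Rightarrow> hyp set" where
  "hyperint U = {ultra_class U X |X. \<forall>i. X i \<in> \<int>}"

definition hless :: "nat filter \<Rightarrow> hyp \<Rightarrow> hyp \<Rightarrow> bool" where
  "hless U x y \<longleftrightarrow> (\<exists>X\<in>x. \<exists>Y\<in>y. \<forall>\<^sub>F i in U. X i < Y i)"

definition hle :: "nat filter \<Rightarrow> hyp \<Rightarrow> hyp \<Rightarrow> bool" where
  "hle U x y \<longleftrightarrow> (\<exists>X\<in>x. \<exists>Y\<in>y. \<forall>\<^sub>F i in U. X i \<le> Y i)"

definition habs :: "nat filter \<Rightarrow> hyp \<Rightarrow> hyp" where
  "habs U = hlift U abs"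

definition hpowr :: "nat filter \<Rightarrow> hyp \<Rightarrow> real \<Rightarrow> hyp" where
  "hpowr U x t = hlift U (\<lambda>a. a powr t) x"

definition hfin :: "nat filter \<Rightarrow> hyp set" where
  "hfin U = {x \<in> carrier (hyperreal U). \<exists>c::real. hle U (habs U x) (hconst U c)}"

definition hinfinitesimal :: "nat filter \<Rightarrow> hyp set" where
  "hinfinitesimal U = {x \<in> carrier (hyperreal U). \<forall>c::real. c > 0 \<longrightarrow> hless U (habs U x) (hconst U c)}"

definition hfin_units_pos :: "nat filter \<Rightarrow> hyp set" where
  "hfin_units_pos U = {x \<in> hfin U. hless U \<zero>\<^bsub>hyperreal U\<^esub> x \<and> x \<notin> hinfinitesimal U}"

definition hnonneg :: "nat filter \<Rightarrow> hyp set" where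
  "hnonneg U = {x \<in> carrier (hyperreal U). hless U \<zero>\<^bsub>hyperreal U\<^esub> x} \<union> {\<zero>\<^bsub>hyperreal U\<^esub>}"

definition growth_rel :: "nat filter \<Rightarrow> hyp rel" where
  "growth_rel U =
     {(x, y). x \<in> hnonneg U \<and> y \<in> hnonneg U \<and> (\<exists>u\<in>hfin_units_pos U. y = u \<otimes>\<^bsub>hyperreal U\<^esub> x)}"

definition growth_class :: "nat filter \<Rightarrow> hyp \<Rightarrow> hyp set" where
  "growth_class U x = growth_rel U `` {habs U x}"

text \<open>The minimum of \<open>\<P>\<close>, written \<open>-\<infinity>\<close>, is the class of zero; it is the only noninvertible element.\<close>

definition growth :: "nat filter \<Rightarrow> hyp set monoid" where
  "growth U =
     \<lparr>carrier = hnonneg U // growth_rel U,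
      mult = (\<lambda>\<mu> \<nu>. \<Union>x\<in>\<mu>. \<Union>y\<in>\<nu>. growth_class U (x \<otimes>\<^bsub>hyperreal U\<^esub> y)),
      one = growth_class U \<one>\<^bsub>hyperreal U\<^esub>\<rparr>"

definition growth_powr :: "nat filter \<Rightarrow> hyp set \<Rightarrow> real \<Rightarrow> hyp set" where
  "growth_powr U \<mu> t = (\<Union>x\<in>\<mu>. growth_class U (hpowr U x t))"

definition growth_less :: "nat filter \<Rightarrow> hyp set \<Rightarrow> hyp set \<Rightarrow> bool" where
  "growth_less U \<mu> \<nu> \<longleftrightarrow> (\<forall>x\<in>\<mu>. \<forall>y\<in>\<nu>. hless U x y)"

definition growth_le :: "nat filter \<Rightarrow> hyp set \<Rightarrow> hyp set \<Rightarrow> bool" where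
  "growth_le U \<mu> \<nu> \<longleftrightarrow> growth_less U \<mu> \<nu> \<or> \<mu> = \<nu>"

definition growth_inf :: "nat filter \<Rightarrow> hyp set set" where
  "growth_inf U = {growth_class U x |x. x \<in> hinfinitesimal U \<and> hless U \<zero>\<^bsub>hyperreal U\<^esub> x}"

definition hzero_vec :: "nat filter \<Rightarrow> hyp ^ 'k" where
  "hzero_vec U = (\<chi> j. \<zero>\<^bsub>hyperreal U\<^esub>)"

definition hmax :: "nat filter \<Rightarrow> hyp ^ 'k \<Rightarrow> hyp" where
  "hmax U v = (THE m. (\<exists>j. m = habs U (v $ j)) \<and> (\<forall>j. hle U (habs U (v $ j)) m))"

definition hmat_vec :: "nat filter \<Rightarrow> real ^ 's ^ 'r \<Rightarrow> hyp ^ 's \<Rightarrow> hyp ^ 'r" where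
  "hmat_vec U \<Theta> n =
     (\<chi> i. \<Oplus>\<^bsub>hyperreal U\<^esub>j\<in>UNIV. hconst U (\<Theta> $ i $ j) \<otimes>\<^bsub>hyperreal U\<^esub> (n $ j))"

definition is_perp :: "nat filter \<Rightarrow> real ^ 's ^ 'r \<Rightarrow> hyp ^ 's \<Rightarrow> hyp ^ 'r \<Rightarrow> bool" where
  "is_perp U \<Theta> n m \<longleftrightarrow>
     (\<forall>i. m $ i \<in> hyperint U \<and> (hmat_vec U \<Theta> n $ i) \<ominus>\<^bsub>hyperreal U\<^esub> (m $ i) \<in> hinfinitesimal U)"

definition hdioph :: "nat filter \<Rightarrow> real ^ 's ^ 'r \<Rightarrow> (hyp ^ 's) set" where
  "hdioph U \<Theta> = {n. (\<forall>j. n $ j \<in> hyperint U) \<and> (\<exists>m. is_perp U \<Theta> n m)}"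

definition herr :: "nat filter \<Rightarrow> real ^ 's ^ 'r \<Rightarrow> hyp ^ 's \<Rightarrow> hyp ^ 'r" where
  "herr U \<Theta> n =
     (\<chi> i. (hmat_vec U \<Theta> n $ i) \<ominus>\<^bsub>hyperreal U\<^esub> ((THE m. is_perp U \<Theta> n m) $ i))"

definition hdioph_filt ::
  "nat filter \<Rightarrow> real ^ 's ^ 'r \<Rightarrow> hyp set \<Rightarrow> hyp set \<Rightarrow> (hyp ^ 's) set" where
  "hdioph_filt U \<Theta> \<mu> \<nu> =
     {n \<in> hdioph U \<Theta>. n \<noteq> hzero_vec U \<and>
        growth_less U (growth_powr U \<mu> (1 / real CARD('s)))
                      (inv\<^bsub>growth U\<^esub> (growth_class U (hmax U n))) \<and>
        growth_le U (growth_class U (hmax U (herr U \<Theta> n)))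
                    (growth_powr U \<nu> (1 / real CARD('r)))}
     \<union> {hzero_vec U}"

definition Spec :: "nat filter \<Rightarrow> real ^ 's ^ 'r \<Rightarrow> (hyp set \<times> hyp set) set" where
  "Spec U \<Theta> =
     {(\<mu>, \<nu>). \<mu> \<in> growth_inf U \<and> \<nu> \<in> growth_inf U \<and> hdioph_filt U \<Theta> \<mu> \<nu> \<noteq> {hzero_vec U}}"

definition Spec_flat :: "nat filter \<Rightarrow> real ^ 's ^ 'r \<Rightarrow> (hyp set \<times> hyp set) set" where
  "Spec_flat U \<Theta> = Spec U \<Theta> \<inter> {(\<mu>, \<nu>). \<mu> = \<nu>}"

definition rational_matrix :: "real ^ 's ^ 'r \<Rightarrow> bool" where
  "rational_matrix \<Theta> \<longleftrightarrow>
     (\<exists>m :: real ^ 's. m \<noteq> 0 \<and> (\<forall>j. m $ j \<in> \<int>) \<and> (\<forall>i. (\<Theta> *v m) $ i \<in> \<int>))"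

definition badly_approximable :: "nat filter \<Rightarrow> real ^ 's ^ 'r \<Rightarrow> bool" where
  "badly_approximable U \<Theta> \<longleftrightarrow>
     (\<exists>C::real. C > 0 \<and>
        (\<forall>n \<in> hdioph U \<Theta>. n \<noteq> hzero_vec U \<longrightarrow>
           hless U (hconst U C)
             ((hmax U n [^]\<^bsub>hyperreal U\<^esub> CARD('s)) \<otimes>\<^bsub>hyperreal U\<^esub>
              (hmax U (herr U \<Theta> n) [^]\<^bsub>hyperreal U\<^esub> CARD('r)))))"

end

theory Submission
  imports Defs "HOL-Library.Landau_Symbols"
begin

text \<open>
  Represent hyperreals by sequences. The order on growth classes of positive sequences then becomes
  Landau comparison along \<open>U\<close>: \<open>\<mu> < \<nu>\<close> is little-o, \<open>\<mu> \<le> \<nu>\<close> is big-O and equality is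
  big-Theta. Write \<open>p\<close> for the size of an approximation and \<open>e > 0\<close> for its error; \<open>e\<close> cannot
  vanish because \<open>\<Theta>\<close> is irrational. If \<open>\<Theta>\<close> is badly approximable, then \<open>p\<^sup>-\<^sup>s = O(e\<^sup>r)\<close>,
  so \<open>\<mu> = o(p\<^sup>-\<^sup>s)\<close> and \<open>e\<^sup>r = O(\<nu>)\<close> force \<open>\<mu> < \<nu>\<close>. Conversely, if \<open>\<mu> < \<nu>\<close>, Dirichlet's
  pigeonhole argument at height \<open>\<nu>\<^sup>-\<^sup>1\<^sup>/\<^sup>s\<close> produces an element of the filtered group. If
  \<open>\<Theta>\<close> is not badly approximable, a diagonal sequence of approximations has \<open>p\<^sup>s e\<^sup>r\<close>
  infinitesimal, and then the class of \<open>e\<^sup>r\<close> lies in the flat spectrum.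
\<close>

section \<open>Dirichlet's theorem for systems of linear forms\<close>

text \<open>Pigeonhole: the integer points of the cube \<open>[0, K]^s\<close> outnumber the
  \<open>L^r\<close> subcubes of side \<open>1 / L\<close> in the unit cube. Hence two of them have
  images under \<open>\<Theta>\<close> whose fractional parts share a subcube, and their difference
  is the required vector. The factor 2 pays for rounding \<open>Q powr (s / r)\<close> down to the
  integer \<open>L\<close>.\<close>

lemma dirichlet_simultaneous:
  fixes \<Theta> :: "real ^ 's ^ 'r"
  assumes Q: "Q \<ge> 1"
  shows "\<exists>n m. n \<noteq> 0 \<and> (\<forall>j. n $ j \<in> \<int>) \<and> (\<forall>i. m $ i \<in> \<int>) \<and> infnorm n \<le> Q \<and>
     infnorm (\<Theta> *v n - m) \<le> 2 * Q powr (- (real CARD('s) / real CARD('r)))"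
proof -
  let ?s = "CARD('s)" and ?r = "CARD('r)"
  define K where "K = nat \<lfloor>Q\<rfloor>"
  \<comment> \<open>With \<open>T\<close> as the ideal number of subdivisions per axis,
    \<open>T ^ r = Q ^ s\<close> balances boxes against points.\<close>
  define T where "T = Q powr (real ?s / real ?r)"
  define L where "L = nat \<lfloor>T\<rfloor>"
  have T: "T \<ge> 1" using Q by (simp add: T_def ge_one_powr_ge_zero)
  have L: "L \<ge> 1" "real L \<le> T" "T < real L + 1"
    using T by (auto simp: L_def le_nat_iff of_nat_nat)
  have K: "K \<ge> 1" "real K \<le> Q" "Q < real K + 1"
    using Q by (auto simp: K_def le_nat_iff of_nat_nat)
  define v :: "('s \<Rightarrow> nat) \<Rightarrow> real ^ 's" where "v = (\<lambda>f. \<chi> j. real (f j))"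
  define box :: "('s \<Rightarrow> nat) \<Rightarrow> 'r \<Rightarrow> nat"
    where "box = (\<lambda>f i. nat \<lfloor>real L * frac ((\<Theta> *v v f) $ i)\<rfloor>)"
  let ?A = "UNIV \<rightarrow>\<^sub>E {0..K} :: ('s \<Rightarrow> nat) set" and ?B = "UNIV \<rightarrow>\<^sub>E {0..<L} :: ('r \<Rightarrow> nat) set"
  have box_less: "real L * frac x < real L" for x
    using L(1) frac_lt_1[of x] by simp
  have "box f \<in> ?B" for f
    using L(1) box_less by (auto simp: box_def nat_less_iff floor_less_iff)
  then have sub: "box ` ?A \<subseteq> ?B" by blast
  \<comment> \<open>Strictness comes from \<open>Q < K + 1\<close>: the coordinates run over
    \<open>K + 1\<close> values, 0 included.\<close>
  have "real (L ^ ?r) \<le> T ^ ?r" using L by (simp add: power_mono)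
  also have "T ^ ?r = Q ^ ?s"
    using Q by (simp add: T_def powr_powr flip: powr_realpow)
  also have "Q ^ ?s < (real K + 1) ^ ?s" using K Q by (intro power_strict_mono) auto
  finally have "real (L ^ ?r) < real ((K + 1) ^ ?s)" by (simp add: add.commute)
  then have "L ^ ?r < (K + 1) ^ ?s" by (simp only: of_nat_less_iff)
  then have "card ?B < card ?A" by (simp add: card_PiE)
  then have "\<not> inj_on box ?A"
    using sub card_inj_on_le[of box ?A ?B] by (auto simp: finite_PiE)
  then obtain f g where fg: "f \<in> ?A" "g \<in> ?A" "f \<noteq> g" "box f = box g"
    by (auto simp: inj_on_def)
  define n where "n = v f - v g"
  \<comment> \<open>Subtracting the integer parts leaves a difference of two fractional parts as the
    error.\<close>
  define m :: "real ^ 'r" where "m = (\<chi> i. of_int (\<lfloor>(\<Theta> *v v f) $ i\<rfloor> - \<lfloor>(\<Theta> *v v g) $ i\<rfloor>))"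
  have "n \<noteq> 0"
    using fg(3) by (auto simp: n_def v_def vec_eq_iff)
  moreover have "\<forall>j. n $ j \<in> \<int>" "\<forall>i. m $ i \<in> \<int>"
    by (auto simp: n_def v_def m_def)
  moreover have "infnorm n \<le> Q"
  proof -
    have "\<bar>n $ j\<bar> \<le> Q" for j
    proof -
      have "f j \<le> K" "g j \<le> K" using fg by auto
      then have "\<bar>real (f j) - real (g j)\<bar> \<le> real K" by linarith
      then show ?thesis using K by (simp add: n_def v_def)
    qed
    then show ?thesis unfolding infnorm_cart by (intro cSup_least) auto
  qed
  moreover have "infnorm (\<Theta> *v n - m) \<le> 2 * Q powr (- (real ?s / real ?r))"
  proof -
    have *: "\<bar>(\<Theta> *v n - m) $ i\<bar> \<le> 1 / L" for i
    proof -
      let ?x = "frac ((\<Theta> *v v f) $ i)" and ?y = "frac ((\<Theta> *v v g) $ i)"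
      have "nat \<lfloor>real L * ?x\<rfloor> = nat \<lfloor>real L * ?y\<rfloor>"
        using fg(4) by (auto simp: box_def dest: fun_cong)
      \<comment> \<open>\<open>nat\<close> sends all negative integers to 0, so nonnegativity is
        what lets it be cancelled.\<close>
      moreover have "0 \<le> \<lfloor>real L * ?x\<rfloor>" "0 \<le> \<lfloor>real L * ?y\<rfloor>" by auto
      ultimately have "\<lfloor>real L * ?x\<rfloor> = \<lfloor>real L * ?y\<rfloor>" by linarith
      then have "\<bar>real L * ?x - real L * ?y\<bar> \<le> 1" by linarith
      then have "real L * \<bar>?x - ?y\<bar> \<le> 1"
        by (simp add: abs_mult flip: right_diff_distrib)
      moreover have "(\<Theta> *v n - m) $ i = ?x - ?y"
        by (simp add: n_def m_def frac_def matrix_vector_mult_diff_distrib)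
      ultimately have "real L * \<bar>(\<Theta> *v n - m) $ i\<bar> \<le> 1" by (simp only:)
      then show ?thesis using L(1) by (simp add: field_simps)
    qed
    have "infnorm (\<Theta> *v n - m) \<le> 1 / L"
      unfolding infnorm_cart using * by (intro cSup_least) auto
    \<comment> \<open>As \<open>L \<ge> 1\<close>, \<open>T < L + 1 \<le> 2 * L\<close>.\<close>
    also have "1 / L \<le> 2 / T"
    proof -
      have "T \<le> real L * 2" using L(3) of_nat_mono[OF L(1), where ?'a = real] by simp
      moreover have "real L > 0" using L(1) by simp
      ultimately show ?thesis using T by (simp add: field_simps)
    qed
    also have "2 / T = 2 * Q powr (- (real ?s / real ?r))"
      by (simp add: T_def powr_minus_divide)
    finally show ?thesis .
  qed
  ultimately show ?thesis by blast
qed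

section \<open>Ultrafilters on the natural numbers\<close>

text \<open>Represents a vector of classes by one sequence of real vectors, so that matrix products
  and \<open>infnorm\<close> can be taken index by index.\<close>

definition hvec :: "nat filter \<Rightarrow> (nat \<Rightarrow> real ^ 'k) \<Rightarrow> hyp ^ 'k" where
  "hvec U N = (\<chi> j. ultra_class U (\<lambda>i. N i $ j))"

locale ultrapower =
  fixes U :: "nat filter"
  assumes nonprincipal: "nonprincipal_ultrafilter U"
begin

abbreviation cls :: "(nat \<Rightarrow> real) \<Rightarrow> hyp" where "cls \<equiv> ultra_class U"

abbreviation gcls :: "(nat \<Rightarrow> real) \<Rightarrow> hyp set" where "gcls X \<equiv> growth_class U (cls X)"

lemma nontrivial: "U \<noteq> bot"
  using nonprincipal by (simp add: nonprincipal_ultrafilter_def)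

lemma eventually_not_iff: "(\<forall>\<^sub>F i in U. \<not> P i) \<longleftrightarrow> \<not> (\<forall>\<^sub>F i in U. P i)"
proof
  assume "\<forall>\<^sub>F i in U. \<not> P i"
  then show "\<not> (\<forall>\<^sub>F i in U. P i)"
    using nontrivial eventually_elim2[of "\<lambda>i. \<not> P i" U P "\<lambda>_. False"]
    by (auto simp: eventually_False)
next
  show "\<not> (\<forall>\<^sub>F i in U. P i) \<Longrightarrow> \<forall>\<^sub>F i in U. \<not> P i"
    using nonprincipal by (auto simp: nonprincipal_ultrafilter_def)
qed

text \<open>If none of finitely many sets is in the ultrafilter, all their complements are, and so
  is the intersection of these. This allows an index-dependent choice among finitely many
  coordinates to be made constant.\<close>

lemma eventually_ex_finite:
  fixes P :: "'k::finite \<Rightarrow> nat \<Rightarrow> bool"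
  assumes "\<forall>\<^sub>F i in U. \<exists>j. P j i"
  shows "\<exists>j. \<forall>\<^sub>F i in U. P j i"
proof (rule ccontr)
  assume "\<nexists>j. \<forall>\<^sub>F i in U. P j i"
  then have "\<forall>\<^sub>F i in U. \<forall>j. \<not> P j i"
    by (intro eventually_all_finite) (simp add: eventually_not_iff)
  with assms have "\<forall>\<^sub>F i in U. False" by eventually_elim blast
  then show False using nontrivial by (simp add: eventually_False)
qed

text \<open>A nonprincipal ultrafilter contains no singleton, hence contains every cofinite set.
  Ordinary limits of sequences thereby pass to \<open>U\<close>.\<close>

lemma le_sequentially: "U \<le> sequentially"
proof -
  have "\<not> (\<forall>\<^sub>F i in U. i = a)" for a
  proof
    assume a: "\<forall>\<^sub>F i in U. i = a"
    \<comment> \<open>An ultrafilter containing a singleton is the principal one at that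
      point.\<close>
    have "eventually P U \<longleftrightarrow> P a" for P
    proof
      assume "eventually P U"
      with a have "\<forall>\<^sub>F i in U. P a" by eventually_elim simp
      then show "P a" using nontrivial by (simp add: eventually_const)
    next
      assume "P a"
      with a show "eventually P U" by (auto elim: eventually_mono)
    qed
    then have "U = principal {a}" by (simp add: filter_eq_iff eventually_principal)
    then show False using nonprincipal by (auto simp: nonprincipal_ultrafilter_def)
  qed
  then have "\<forall>\<^sub>F i in U. \<forall>a\<in>{..<n}. i \<noteq> a" for n
    by (intro eventually_ball_finite) (auto simp: eventually_not_iff)
  then have ge: "\<forall>\<^sub>F i in U. n \<le> i" for n
    by (rule eventually_mono[of "\<lambda>i. \<forall>a\<in>{..<n}. i \<noteq> a"]) (auto simp: not_less[symmetric])
  show ?thesis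
  proof (rule filter_leI)
    fix P assume "eventually P sequentially"
    then obtain n where "\<And>i. n \<le> i \<Longrightarrow> P i" by (auto simp: eventually_sequentially)
    then show "eventually P U" by (rule eventually_mono[OF ge])
  qed
qed

section \<open>Hyperreal arithmetic and order on representatives\<close>

lemma mem_cls_iff: "Y \<in> cls X \<longleftrightarrow> (\<forall>\<^sub>F i in U. X i = Y i)"
  by (simp add: ultra_class_def ultra_rel_def)

lemma cls_self: "X \<in> cls X"
  by (simp add: mem_cls_iff)

lemma cls_nonempty: "cls X \<noteq> {}"
  using cls_self[of X] by blast

lemma cls_eq_iff: "cls X = cls Y \<longleftrightarrow> (\<forall>\<^sub>F i in U. X i = Y i)"
proof
  show "cls X = cls Y \<Longrightarrow> \<forall>\<^sub>F i in U. X i = Y i"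
    using cls_self[of Y] by (simp flip: mem_cls_iff)
next
  assume XY: "\<forall>\<^sub>F i in U. X i = Y i"
  show "cls X = cls Y"
  proof (intro equalityI subsetI)
    fix Z assume "Z \<in> cls X"
    with XY show "Z \<in> cls Y" unfolding mem_cls_iff by eventually_elim simp
  next
    fix Z assume "Z \<in> cls Y"
    with XY show "Z \<in> cls X" unfolding mem_cls_iff by eventually_elim simp
  qed
qed

lemma carrier_hyperreal: "carrier (hyperreal U) = range cls"
  by (auto simp: hyperreal_def quotient_def ultra_class_def)

lemma hlift_cls: "hlift U f (cls X) = cls (\<lambda>i. f (X i))"
proof -
  have "cls (\<lambda>i. f (Y i)) = cls (\<lambda>i. f (X i))" if "Y \<in> cls X" for Y
    using that unfolding mem_cls_iff cls_eq_iff by eventually_elim simp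
  then show ?thesis unfolding hlift_def by (intro SUP_eq_const cls_nonempty)
qed

lemma hlift2_cls: "hlift2 U f (cls X) (cls Y) = cls (\<lambda>i. f (X i) (Y i))"
proof -
  have "cls (\<lambda>i. f (X' i) (Y' i)) = cls (\<lambda>i. f (X i) (Y i))" if "X' \<in> cls X" "Y' \<in> cls Y" for X' Y'
    using that unfolding mem_cls_iff cls_eq_iff by eventually_elim simp
  then show ?thesis unfolding hlift2_def by (intro SUP_eq_const cls_nonempty)
qed

lemma hyperreal_simps:
  "cls X \<in> carrier (hyperreal U)"
  "cls X \<otimes>\<^bsub>hyperreal U\<^esub> cls Y = cls (\<lambda>i. X i * Y i)"
  "cls X \<oplus>\<^bsub>hyperreal U\<^esub> cls Y = cls (\<lambda>i. X i + Y i)"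
  "\<zero>\<^bsub>hyperreal U\<^esub> = cls (\<lambda>_. 0)"
  "\<one>\<^bsub>hyperreal U\<^esub> = cls (\<lambda>_. 1)"
  "hconst U c = cls (\<lambda>_. c)"
  "habs U (cls X) = cls (\<lambda>i. \<bar>X i\<bar>)"
  "hpowr U (cls X) t = cls (\<lambda>i. X i powr t)"
  by (simp add: carrier_hyperreal)
     (simp_all add: hyperreal_def hlift_cls hlift2_cls hconst_def habs_def hpowr_def)

lemma hless_cls: "hless U (cls X) (cls Y) \<longleftrightarrow> (\<forall>\<^sub>F i in U. X i < Y i)"
proof
  assume "hless U (cls X) (cls Y)"
  then obtain X' Y' where "\<forall>\<^sub>F i in U. X i = X' i" "\<forall>\<^sub>F i in U. Y i = Y' i"
    "\<forall>\<^sub>F i in U. X' i < Y' i" by (auto simp: hless_def mem_cls_iff)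
  then show "\<forall>\<^sub>F i in U. X i < Y i" by eventually_elim simp
qed (auto simp: hless_def intro!: bexI[OF bexI[OF _ cls_self] cls_self])

lemma hle_cls: "hle U (cls X) (cls Y) \<longleftrightarrow> (\<forall>\<^sub>F i in U. X i \<le> Y i)"
proof
  assume "hle U (cls X) (cls Y)"
  then obtain X' Y' where "\<forall>\<^sub>F i in U. X i = X' i" "\<forall>\<^sub>F i in U. Y i = Y' i"
    "\<forall>\<^sub>F i in U. X' i \<le> Y' i" by (auto simp: hle_def mem_cls_iff)
  then show "\<forall>\<^sub>F i in U. X i \<le> Y i" by eventually_elim simp
qed (auto simp: hle_def intro!: bexI[OF bexI[OF _ cls_self] cls_self])

text \<open>The ring laws give access to the library rules that evaluate subtraction, powers and
  finite sums on representatives.\<close>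

lemma cring_hyperreal: "cring (hyperreal U)"
proof (intro cringI abelian_groupI comm_monoidI)
  fix x assume "x \<in> carrier (hyperreal U)"
  then obtain X where "x = cls X" by (auto simp: carrier_hyperreal)
  then have "cls (\<lambda>i. - X i) \<oplus>\<^bsub>hyperreal U\<^esub> x = \<zero>\<^bsub>hyperreal U\<^esub>"
    by (simp add: hyperreal_simps)
  then show "\<exists>y\<in>carrier (hyperreal U). y \<oplus>\<^bsub>hyperreal U\<^esub> x = \<zero>\<^bsub>hyperreal U\<^esub>"
    using hyperreal_simps(1) by blast
qed (auto simp: carrier_hyperreal hyperreal_simps algebra_simps)

sublocale R: cring "hyperreal U"
  by (rule cring_hyperreal)

lemma minus_cls: "cls X \<ominus>\<^bsub>hyperreal U\<^esub> cls Y = cls (\<lambda>i. X i - Y i)"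
proof -
  have "\<ominus>\<^bsub>hyperreal U\<^esub> cls Y = cls (\<lambda>i. - Y i)"
    by (rule R.minus_equality) (simp_all add: hyperreal_simps)
  then show ?thesis by (simp add: a_minus_def hyperreal_simps)
qed

lemma pow_cls: "cls X [^]\<^bsub>hyperreal U\<^esub> (k::nat) = cls (\<lambda>i. X i ^ k)"
  by (induction k) (simp_all add: hyperreal_simps mult.commute)

lemma finsum_cls:
  assumes "finite A"
  shows "(\<Oplus>\<^bsub>hyperreal U\<^esub>j\<in>A. cls (f j)) = cls (\<lambda>i. \<Sum>j\<in>A. f j i)"
  using assms
  by (induction A rule: finite_induct) (simp_all add: hyperreal_simps Pi_def)

section \<open>Growth classes as Landau classes along \<open>U\<close>\<close>

lemma hinfinitesimal_cls: "cls X \<in> hinfinitesimal U \<longleftrightarrow> X \<in> o[U](\<lambda>_. 1)"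
proof
  assume "cls X \<in> hinfinitesimal U"
  then show "X \<in> o[U](\<lambda>_. 1)"
    by (auto simp: hinfinitesimal_def hyperreal_simps hless_cls elim!: eventually_mono
        intro!: landau_o.smallI)
next
  assume X: "X \<in> o[U](\<lambda>_. 1)"
  have "\<forall>\<^sub>F i in U. \<bar>X i\<bar> < c" if "c > 0" for c
    using landau_o.smallD[OF X, of "c / 2"] that by (auto elim: eventually_mono)
  then show "cls X \<in> hinfinitesimal U"
    by (simp add: hinfinitesimal_def hyperreal_simps hless_cls)
qed

lemma hfin_cls: "cls X \<in> hfin U \<longleftrightarrow> X \<in> O[U](\<lambda>_. 1)"
  by (auto simp: hfin_def hyperreal_simps hle_cls elim!: landau_o.bigE intro: bigoI[of _ _ "\<lambda>_. 1"])

text \<open>This is the totality of the order on growth classes. It rests on the ultrafilter: a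
  bound that does not hold eventually is reversed eventually, whereas a general filter would only
  give the reverse bound frequently.\<close>

lemma not_smallo_imp_bigo:
  fixes X Y :: "nat \<Rightarrow> real"
  assumes "X \<notin> o[U](Y)"
  shows "Y \<in> O[U](X)"
proof -
  obtain c where c: "c > 0" "\<not> (\<forall>\<^sub>F i in U. \<bar>X i\<bar> \<le> c * \<bar>Y i\<bar>)"
    using assms landau_o.smallI[where f=X and g=Y and F=U] by auto
  then have "\<forall>\<^sub>F i in U. \<not> \<bar>X i\<bar> \<le> c * \<bar>Y i\<bar>" by (simp add: eventually_not_iff)
  then have "\<forall>\<^sub>F i in U. norm (Y i) \<le> (1 / c) * norm (X i)"
    by eventually_elim (use c in \<open>simp add: field_simps\<close>)
  then show ?thesis by (rule bigoI)
qed

lemma bigtheta_iff_bigo_not_smallo: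
  fixes X Y :: "nat \<Rightarrow> real"
  assumes "\<forall>\<^sub>F i in U. 0 < X i"
  shows "X \<in> \<Theta>[U](Y) \<longleftrightarrow> X \<in> O[U](Y) \<and> X \<notin> o[U](Y)"
proof -
  \<comment> \<open>Little-o and big-O in opposite directions are compatible only for functions that
    vanish eventually.\<close>
  have "\<not> (\<forall>\<^sub>F i in U. X i = 0)"
    using assms by (auto simp: eventually_not_iff[symmetric] elim: eventually_mono)
  then have "X \<in> o[U](Y) \<Longrightarrow> Y \<notin> O[U](X)"
    using landau_o.small_big_asymmetric by blast
  then show ?thesis
    using not_smallo_imp_bigo by (auto simp: bigtheta_def bigomega_iff_bigo)
qed

lemma hfin_units_pos_cls:
  "cls X \<in> hfin_units_pos U \<longleftrightarrow> (\<forall>\<^sub>F i in U. 0 < X i) \<and> X \<in> \<Theta>[U](\<lambda>_. 1)"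
  using bigtheta_iff_bigo_not_smallo[of X "\<lambda>_. 1"]
  by (auto simp: hfin_units_pos_def hyperreal_simps hless_cls hfin_cls hinfinitesimal_cls)

lemma habs_pos:
  assumes "\<forall>\<^sub>F i in U. 0 < X i"
  shows "habs U (cls X) = cls X"
  using assms by (auto simp: hyperreal_simps cls_eq_iff elim: eventually_mono)

text \<open>Positive elements that are neither infinite nor infinitesimal are the positive sequences
  in \<open>\<Theta>[U](\<lambda>_. 1)\<close>. Multiplying \<open>X\<close> by them sweeps out the
  positive sequences comparable to \<open>X\<close>, the unit for a given \<open>Y\<close> being
  \<open>Y / X\<close>.\<close>

lemma growth_class_eq:
  assumes X: "\<forall>\<^sub>F i in U. 0 < X i"
  shows "gcls X = {cls Y |Y. (\<forall>\<^sub>F i in U. 0 < Y i) \<and> Y \<in> \<Theta>[U](X)}"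
proof (intro equalityI subsetI)
  fix y assume "y \<in> gcls X"
  then obtain u where u: "u \<in> hfin_units_pos U" "y = u \<otimes>\<^bsub>hyperreal U\<^esub> cls X"
    using X by (auto simp: growth_class_def growth_rel_def habs_pos)
  from u(1) obtain W where "u = cls W"
    by (auto simp: hfin_units_pos_def hfin_def carrier_hyperreal)
  with u have W: "\<forall>\<^sub>F i in U. 0 < W i" "W \<in> \<Theta>[U](\<lambda>_. 1)" "y = cls (\<lambda>i. W i * X i)"
    by (simp_all add: hfin_units_pos_cls hyperreal_simps)
  have "(\<lambda>i. W i * X i) \<in> \<Theta>[U](X)"
    using landau_theta.mult[OF W(2), of X X] by simp
  moreover have "\<forall>\<^sub>F i in U. 0 < W i * X i" using W(1) X by eventually_elim simp
  ultimately show "y \<in> {cls Y |Y. (\<forall>\<^sub>F i in U. 0 < Y i) \<and> Y \<in> \<Theta>[U](X)}"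
    using W(3) by blast
next
  fix y assume "y \<in> {cls Y |Y. (\<forall>\<^sub>F i in U. 0 < Y i) \<and> Y \<in> \<Theta>[U](X)}"
  then obtain Y where Y: "y = cls Y" "\<forall>\<^sub>F i in U. 0 < Y i" "Y \<in> \<Theta>[U](X)" by blast
  have "(\<lambda>i. Y i / X i) \<in> \<Theta>[U](\<lambda>i. X i / X i)"
    using Y(3) X by (intro landau_theta.divide) (auto elim: eventually_mono)
  also have "(\<lambda>i. X i / X i) \<in> \<Theta>[U](\<lambda>_. 1)"
    using X by (intro bigthetaI_cong) (auto elim: eventually_mono)
  finally have "(\<lambda>i. Y i / X i) \<in> \<Theta>[U](\<lambda>_. 1)" .
  moreover have "\<forall>\<^sub>F i in U. 0 < Y i / X i" using X Y(2) by eventually_elim simp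
  ultimately have "cls (\<lambda>i. Y i / X i) \<in> hfin_units_pos U" by (simp add: hfin_units_pos_cls)
  moreover have "y = cls (\<lambda>i. Y i / X i) \<otimes>\<^bsub>hyperreal U\<^esub> cls X"
    using X by (auto simp: Y hyperreal_simps cls_eq_iff elim: eventually_mono)
  moreover have "y \<in> hnonneg U" "cls X \<in> hnonneg U"
    using X Y by (auto simp: hnonneg_def hyperreal_simps hless_cls)
  ultimately show "y \<in> gcls X"
    using X by (auto simp: growth_class_def growth_rel_def habs_pos)
qed

lemma growth_class_self:
  assumes "\<forall>\<^sub>F i in U. 0 < X i"
  shows "cls X \<in> gcls X"
  using assms by (auto simp: growth_class_eq)

lemma growth_class_cong:
  assumes "\<forall>\<^sub>F i in U. 0 < X i" "\<forall>\<^sub>F i in U. 0 < Y i"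
  shows "gcls X = gcls Y \<longleftrightarrow> X \<in> \<Theta>[U](Y)"
proof
  assume "gcls X = gcls Y"
  moreover have "cls X \<in> gcls X" using assms(1) by (rule growth_class_self)
  ultimately obtain X' where X': "cls X = cls X'" "X' \<in> \<Theta>[U](Y)"
    using assms by (auto simp: growth_class_eq)
  then have "X \<in> \<Theta>[U](X')" by (intro bigthetaI_cong) (simp add: cls_eq_iff)
  then show "X \<in> \<Theta>[U](Y)" using X'(2) by (rule landau_theta.trans)
next
  assume XY: "X \<in> \<Theta>[U](Y)"
  have "Z \<in> \<Theta>[U](X) \<longleftrightarrow> Z \<in> \<Theta>[U](Y)" for Z :: "nat \<Rightarrow> real"
    using landau_theta.cong_bigtheta[OF XY] by simp
  then show "gcls X = gcls Y" using assms by (simp add: growth_class_eq)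
qed

lemma growth_less_iff:
  assumes X: "\<forall>\<^sub>F i in U. 0 < X i" and Y: "\<forall>\<^sub>F i in U. 0 < Y i"
  shows "growth_less U (gcls X) (gcls Y) \<longleftrightarrow> X \<in> o[U](Y)"
proof
  assume less: "growth_less U (gcls X) (gcls Y)"
  show "X \<in> o[U](Y)"
  proof (rule landau_o.smallI)
    fix c :: real assume c: "c > 0"
    have "cls X \<in> gcls X" using X by (rule growth_class_self)
    \<comment> \<open>Every positive real multiple of \<open>Y\<close> represents the same class, so
      comparing all representatives yields the bound for every constant \<open>c\<close>.\<close>
    moreover have "cls (\<lambda>i. c * Y i) \<in> gcls Y"
      unfolding growth_class_eq[OF Y] mem_Collect_eq
      by (rule exI[of _ "\<lambda>i. c * Y i"]) (use Y c in \<open>auto elim!: eventually_mono\<close>)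
    ultimately have "\<forall>\<^sub>F i in U. X i < c * Y i"
      using less unfolding growth_less_def hless_cls[symmetric] by blast
    then show "\<forall>\<^sub>F i in U. norm (X i) \<le> c * norm (Y i)"
      using X Y by eventually_elim simp
  qed
next
  assume XY: "X \<in> o[U](Y)"
  have "hless U (cls X') (cls Y')"
    if X': "\<forall>\<^sub>F i in U. 0 < X' i" "X' \<in> \<Theta>[U](X)" and Y': "\<forall>\<^sub>F i in U. 0 < Y' i" "Y' \<in> \<Theta>[U](Y)"
    for X' Y'
  proof -
    note X'(2)
    also note XY
    also have "Y \<in> \<Theta>[U](Y')" using Y'(2) by (simp add: bigtheta_sym)
    finally have "X' \<in> o[U](Y')" .
    \<comment> \<open>Any constant below 1 serves; with \<open>Y'\<close> positive it turns the weak
      bound into a strict inequality.\<close>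
    from landau_o.smallD[OF this, of "1 / 2"]
    have "\<forall>\<^sub>F i in U. norm (X' i) \<le> 1 / 2 * norm (Y' i)" by simp
    then have "\<forall>\<^sub>F i in U. X' i < Y' i" using Y'(1) by eventually_elim simp
    then show ?thesis by (simp add: hless_cls)
  qed
  then show "growth_less U (gcls X) (gcls Y)"
    unfolding growth_less_def growth_class_eq[OF X] growth_class_eq[OF Y] by blast
qed

text \<open>For positive sequences big-O splits into little-o and big-Theta, matching the strict
  case and the equality case of \<open>growth_le\<close>.\<close>

lemma growth_le_iff:
  assumes X: "\<forall>\<^sub>F i in U. 0 < X i" and Y: "\<forall>\<^sub>F i in U. 0 < Y i"
  shows "growth_le U (gcls X) (gcls Y) \<longleftrightarrow> X \<in> O[U](Y)"
  using bigtheta_iff_bigo_not_smallo[OF X, of Y] landau_o.small_imp_big[of X U Y]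
  by (auto simp: growth_le_def growth_less_iff growth_class_cong X Y)

lemma growth_powr_gcls:
  assumes X: "\<forall>\<^sub>F i in U. 0 < X i"
  shows "growth_powr U (gcls X) t = gcls (\<lambda>i. X i powr t)"
proof -
  have "gcls (\<lambda>i. Y i powr t) = gcls (\<lambda>i. X i powr t)"
    if Y: "\<forall>\<^sub>F i in U. 0 < Y i" "Y \<in> \<Theta>[U](X)" for Y
  proof -
    have "(\<lambda>i. Y i powr t) \<in> \<Theta>[U](\<lambda>i. \<bar>Y i\<bar> powr t)"
      using Y(1) by (intro bigthetaI_cong) (auto elim: eventually_mono)
    also have "(\<lambda>i. \<bar>Y i\<bar> powr t) \<in> \<Theta>[U](\<lambda>i. \<bar>X i\<bar> powr t)"
      using Y(2) by (rule bigtheta_powr)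
    also have "(\<lambda>i. \<bar>X i\<bar> powr t) \<in> \<Theta>[U](\<lambda>i. X i powr t)"
      using X by (intro bigthetaI_cong) (auto elim: eventually_mono)
    finally have "(\<lambda>i. Y i powr t) \<in> \<Theta>[U](\<lambda>i. X i powr t)" .
    moreover have "\<forall>\<^sub>F i in U. 0 < X i powr t" using X by eventually_elim simp
    moreover have "\<forall>\<^sub>F i in U. 0 < Y i powr t" using Y(1) by eventually_elim simp
    ultimately show ?thesis by (simp add: growth_class_cong)
  qed
  then have "growth_class U (hpowr U y t) = gcls (\<lambda>i. X i powr t)" if "y \<in> gcls X" for y
    using that unfolding growth_class_eq[OF X] by (force simp: hyperreal_simps)
  moreover have "gcls X \<noteq> {}" using growth_class_self[OF X] by blast
  ultimately show ?thesis
    unfolding growth_powr_def by (intro SUP_eq_const)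
qed

lemma growth_mult_gcls:
  assumes X: "\<forall>\<^sub>F i in U. 0 < X i" and Y: "\<forall>\<^sub>F i in U. 0 < Y i"
  shows "gcls X \<otimes>\<^bsub>growth U\<^esub> gcls Y = gcls (\<lambda>i. X i * Y i)"
proof -
  have XY: "\<forall>\<^sub>F i in U. 0 < X i * Y i" using X Y by eventually_elim simp
  have "gcls (\<lambda>i. X' i * Y' i) = gcls (\<lambda>i. X i * Y i)"
    if X': "\<forall>\<^sub>F i in U. 0 < X' i" "X' \<in> \<Theta>[U](X)" and Y': "\<forall>\<^sub>F i in U. 0 < Y' i" "Y' \<in> \<Theta>[U](Y)"
    for X' Y'
  proof -
    have "\<forall>\<^sub>F i in U. 0 < X' i * Y' i" using X'(1) Y'(1) by eventually_elim simp
    then show ?thesis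
      using XY landau_theta.mult[OF X'(2) Y'(2)] by (simp add: growth_class_cong)
  qed
  then have "growth_class U (x \<otimes>\<^bsub>hyperreal U\<^esub> y) = gcls (\<lambda>i. X i * Y i)"
    if "x \<in> gcls X" "y \<in> gcls Y" for x y
    using that unfolding growth_class_eq[OF X] growth_class_eq[OF Y] by (force simp: hyperreal_simps)
  moreover have "gcls X \<noteq> {}" "gcls Y \<noteq> {}"
    using growth_class_self[OF X] growth_class_self[OF Y] by blast+
  ultimately show ?thesis
    unfolding growth_def monoid.simps by (intro SUP_eq_const)
qed

text \<open>Serves to exclude the class of zero as an inverse in
  \<open>growth_inv_gcls\<close>.\<close>

lemma growth_class_zero: "gcls (\<lambda>_. 0) \<subseteq> {cls (\<lambda>_. 0)}"
  by (auto simp: growth_class_def growth_rel_def hfin_units_pos_def hfin_def carrier_hyperreal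
      hyperreal_simps)

lemma one_growth: "\<one>\<^bsub>growth U\<^esub> = gcls (\<lambda>_. 1)"
  by (simp add: growth_def hyperreal_simps)

lemma carrier_growth_cases:
  assumes "\<mu> \<in> carrier (growth U)"
  obtains X where "\<forall>\<^sub>F i in U. 0 < X i" "\<mu> = gcls X" | "\<mu> = gcls (\<lambda>_. 0)"
proof -
  obtain x where x: "x \<in> hnonneg U" "\<mu> = growth_rel U `` {x}"
    using assms by (auto simp: growth_def elim: quotientE)
  then consider X where "x = cls X" "\<forall>\<^sub>F i in U. 0 < X i" | "x = cls (\<lambda>_. 0)"
    by (auto simp: hnonneg_def carrier_hyperreal hyperreal_simps hless_cls)
  then show thesis
  proof cases
    case 1
    then show thesis using that(1)[of X] x(2) by (simp add: growth_class_def habs_pos)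
  next
    case 2
    then show thesis using that(2) x(2) by (simp add: growth_class_def hyperreal_simps)
  qed
qed

lemma growth_mult_zero:
  assumes X: "\<forall>\<^sub>F i in U. 0 < X i"
  shows "gcls X \<otimes>\<^bsub>growth U\<^esub> gcls (\<lambda>_. 0) \<subseteq> {cls (\<lambda>_. 0)}"
proof -
  have "growth_class U (x \<otimes>\<^bsub>hyperreal U\<^esub> y) \<subseteq> {cls (\<lambda>_. 0)}"
    if "x \<in> gcls X" "y \<in> gcls (\<lambda>_. 0)" for x y
  proof -
    from that(1) obtain X' where "x = cls X'" using X by (auto simp: growth_class_eq)
    moreover have "y = cls (\<lambda>_. 0)" using that(2) growth_class_zero by blast
    ultimately show ?thesis using growth_class_zero by (simp add: hyperreal_simps)
  qed
  then show ?thesis unfolding growth_def monoid.simps by (intro UN_least)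
qed

text \<open>The inverse is a definite description over the whole carrier. Uniqueness therefore needs
  two cases: a positive candidate is determined by cancelling \<open>X\<close>, and the class of
  zero is ruled out.\<close>

lemma growth_inv_gcls:
  assumes X: "\<forall>\<^sub>F i in U. 0 < X i"
  shows "inv\<^bsub>growth U\<^esub> (gcls X) = gcls (\<lambda>i. inverse (X i))"
proof -
  let ?Z = "\<lambda>i. inverse (X i)"
  have Z: "\<forall>\<^sub>F i in U. 0 < ?Z i" using X by eventually_elim simp
  have "(\<lambda>i. X i * ?Z i) \<in> \<Theta>[U](\<lambda>_. 1)" "(\<lambda>i. ?Z i * X i) \<in> \<Theta>[U](\<lambda>_. 1)"
    using X by (auto intro!: bigthetaI_cong elim!: eventually_mono)
  moreover have "\<forall>\<^sub>F i in U. 0 < X i * ?Z i" "\<forall>\<^sub>F i in U. 0 < ?Z i * X i"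
    using X by (auto elim!: eventually_mono)
  ultimately have inv: "gcls X \<otimes>\<^bsub>growth U\<^esub> gcls ?Z = \<one>\<^bsub>growth U\<^esub>"
      "gcls ?Z \<otimes>\<^bsub>growth U\<^esub> gcls X = \<one>\<^bsub>growth U\<^esub>"
    using X Z by (simp_all add: growth_mult_gcls one_growth growth_class_cong)
  have "cls ?Z \<in> hnonneg U" using Z by (simp add: hnonneg_def hyperreal_simps hless_cls)
  then have carrier: "gcls ?Z \<in> carrier (growth U)"
    using Z by (auto simp: growth_def growth_class_def habs_pos intro: quotientI)
  have "\<mu> = gcls ?Z"
    if \<mu>: "\<mu> \<in> carrier (growth U)" "gcls X \<otimes>\<^bsub>growth U\<^esub> \<mu> = \<one>\<^bsub>growth U\<^esub>" for \<mu>
    using \<mu>(1)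
  proof (cases rule: carrier_growth_cases)
    case (1 Y)
    have XY: "\<forall>\<^sub>F i in U. 0 < X i * Y i" using X 1(1) by eventually_elim simp
    have "(\<lambda>i. X i * Y i) \<in> \<Theta>[U](\<lambda>_. 1)"
      using \<mu>(2) XY X 1 by (simp add: growth_mult_gcls one_growth growth_class_cong)
    from landau_theta.mult[OF _ this, of ?Z ?Z]
    have *: "(\<lambda>i. ?Z i * (X i * Y i)) \<in> \<Theta>[U](?Z)" by simp
    have "Y \<in> \<Theta>[U](\<lambda>i. ?Z i * (X i * Y i))"
      using X by (intro bigthetaI_cong) (auto elim!: eventually_mono)
    also note *
    finally show ?thesis using 1 Z by (simp add: growth_class_cong)
  next
    case 2
    \<comment> \<open>A product with the class of zero contains at most 0, but the unit class
      contains 1; this would force \<open>1 = 0\<close> on a set of \<open>U\<close>.\<close>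
    have "cls (\<lambda>_. 1) \<in> \<one>\<^bsub>growth U\<^esub>" by (simp add: one_growth growth_class_self)
    then have "cls (\<lambda>_. 1) = cls (\<lambda>_. 0)" using \<mu>(2) 2 growth_mult_zero[OF X] by auto
    then show ?thesis using nontrivial by (simp add: cls_eq_iff eventually_False)
  qed
  then show ?thesis
    unfolding m_inv_def using inv carrier by (intro the_equality) blast+
qed

lemma growth_inf_iff:
  "\<mu> \<in> growth_inf U \<longleftrightarrow> (\<exists>X. (\<forall>\<^sub>F i in U. 0 < X i) \<and> X \<in> o[U](\<lambda>_. 1) \<and> \<mu> = gcls X)"
proof
  assume "\<mu> \<in> growth_inf U"
  then obtain x where x: "\<mu> = growth_class U x" "x \<in> hinfinitesimal U"
    "hless U \<zero>\<^bsub>hyperreal U\<^esub> x" by (auto simp: growth_inf_def)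
  moreover from x(2) obtain X where "x = cls X" by (auto simp: hinfinitesimal_def carrier_hyperreal)
  ultimately show "\<exists>X. (\<forall>\<^sub>F i in U. 0 < X i) \<and> X \<in> o[U](\<lambda>_. 1) \<and> \<mu> = gcls X"
    by (auto simp: hinfinitesimal_cls hyperreal_simps hless_cls)
next
  assume "\<exists>X. (\<forall>\<^sub>F i in U. 0 < X i) \<and> X \<in> o[U](\<lambda>_. 1) \<and> \<mu> = gcls X"
  then obtain X where "\<forall>\<^sub>F i in U. 0 < X i" "X \<in> o[U](\<lambda>_. 1)" "\<mu> = gcls X" by blast
  moreover from this have "cls X \<in> hinfinitesimal U" "hless U \<zero>\<^bsub>hyperreal U\<^esub> (cls X)"
    by (simp_all add: hinfinitesimal_cls hyperreal_simps hless_cls)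
  ultimately show "\<mu> \<in> growth_inf U" unfolding growth_inf_def by blast
qed

section \<open>Hyperreal vectors and Diophantine approximations\<close>

lemma hvec_eq_iff: "hvec U N = hvec U M \<longleftrightarrow> (\<forall>\<^sub>F i in U. N i = M i)"
proof -
  have "(\<forall>j. \<forall>\<^sub>F i in U. N i $ j = M i $ j) \<longleftrightarrow> (\<forall>\<^sub>F i in U. \<forall>j. N i $ j = M i $ j)"
    using eventually_all_finite[of "\<lambda>i j. N i $ j = M i $ j" U] by (auto elim!: eventually_mono)
  then show ?thesis by (simp add: hvec_def vec_eq_iff cls_eq_iff)
qed

lemma hzero_vec_eq: "hzero_vec U = hvec U (\<lambda>_. 0)"
  by (simp add: hzero_vec_def hvec_def hyperreal_simps)

lemma hmat_vec_hvec: "hmat_vec U \<Theta> (hvec U N) = hvec U (\<lambda>i. \<Theta> *v N i)"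
  by (simp add: hmat_vec_def hvec_def hyperreal_simps finsum_cls matrix_vector_mult_def)

text \<open>The coordinate attaining the maximum may change with the index, but there are finitely
  many, so one of them attains it on a set of \<open>U\<close>.\<close>

lemma hmax_hvec: "hmax U (hvec U N) = cls (\<lambda>i. infnorm (N i))"
proof -
  have "\<exists>j. infnorm x = \<bar>x $ j\<bar>" for x :: "real ^ 'a"
  proof -
    have "finite (range (\<lambda>j. \<bar>x $ j\<bar>))" by simp
    then have "Max (range (\<lambda>j. \<bar>x $ j\<bar>)) \<in> range (\<lambda>j. \<bar>x $ j\<bar>)" by (intro Max_in) auto
    moreover have "infnorm x = Max (range (\<lambda>j. \<bar>x $ j\<bar>))"
      unfolding infnorm_cart by (subst cSup_eq_Max[symmetric]) (auto simp: full_SetCompr_eq)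
    ultimately show ?thesis by (metis imageE)
  qed
  then have "\<forall>\<^sub>F i in U. \<exists>j. infnorm (N i) = \<bar>N i $ j\<bar>" by simp
  then obtain j0 where j0: "\<forall>\<^sub>F i in U. infnorm (N i) = \<bar>N i $ j0\<bar>"
    using eventually_ex_finite[of "\<lambda>j i. infnorm (N i) = \<bar>N i $ j\<bar>"] by blast
  show ?thesis unfolding hmax_def
  proof (rule the_equality)
    have "cls (\<lambda>i. infnorm (N i)) = habs U (hvec U N $ j0)"
      using j0 by (simp add: hvec_def hyperreal_simps cls_eq_iff)
    moreover have "hle U (habs U (hvec U N $ j)) (cls (\<lambda>i. infnorm (N i)))" for j
      by (simp add: hvec_def hyperreal_simps hle_cls component_le_infnorm_cart)
    ultimately show "(\<exists>j. cls (\<lambda>i. infnorm (N i)) = habs U (hvec U N $ j)) \<and>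
        (\<forall>j. hle U (habs U (hvec U N $ j)) (cls (\<lambda>i. infnorm (N i))))"
      by blast
  next
    fix m assume m: "(\<exists>j. m = habs U (hvec U N $ j)) \<and> (\<forall>j. hle U (habs U (hvec U N $ j)) m)"
    then obtain j where j: "m = cls (\<lambda>i. \<bar>N i $ j\<bar>)" by (auto simp: hvec_def hyperreal_simps)
    have "hle U (habs U (hvec U N $ j0)) m" using m by blast
    then have "\<forall>\<^sub>F i in U. \<bar>N i $ j0\<bar> \<le> \<bar>N i $ j\<bar>"
      by (simp add: j hvec_def hyperreal_simps hle_cls)
    then have "\<forall>\<^sub>F i in U. \<bar>N i $ j\<bar> = infnorm (N i)"
      using j0
    proof eventually_elim
      case (elim i)
      then show ?case using component_le_infnorm_cart[of "N i" j] by linarith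
    qed
    then show "m = cls (\<lambda>i. infnorm (N i))" by (simp add: j cls_eq_iff)
  qed
qed

lemma hyperint_vec_iff:
  "(\<forall>j. n $ j \<in> hyperint U) \<longleftrightarrow> (\<exists>N. (\<forall>i j. N i $ j \<in> \<int>) \<and> n = hvec U N)"
proof
  assume "\<forall>j. n $ j \<in> hyperint U"
  then have "\<forall>j. \<exists>X. n $ j = cls X \<and> (\<forall>i. X i \<in> \<int>)" by (auto simp: hyperint_def)
  then obtain X where X: "\<And>j. n $ j = cls (X j)" "\<And>j i. X j i \<in> \<int>" by metis
  then show "\<exists>N. (\<forall>i j. N i $ j \<in> \<int>) \<and> n = hvec U N"
    by (intro exI[of _ "\<lambda>i. \<chi> j. X j i"]) (simp add: hvec_def vec_eq_iff)
qed (auto simp: hvec_def hyperint_def)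

lemma infnorm_smallo_iff:
  fixes E :: "nat \<Rightarrow> real ^ 'k"
  shows "(\<lambda>i. infnorm (E i)) \<in> o[U](\<lambda>_. 1) \<longleftrightarrow> (\<forall>j. (\<lambda>i. E i $ j) \<in> o[U](\<lambda>_. 1))"
proof safe
  fix j assume E: "(\<lambda>i. infnorm (E i)) \<in> o[U](\<lambda>_. 1)"
  have "(\<lambda>i. E i $ j) \<in> O[U](\<lambda>i. infnorm (E i))"
    by (intro bigoI[of _ 1]) (simp add: component_le_infnorm_cart infnorm_pos_le)
  then show "(\<lambda>i. E i $ j) \<in> o[U](\<lambda>_. 1)" using E by (rule landau_o.big_small_trans)
next
  assume E: "\<forall>j. (\<lambda>i. E i $ j) \<in> o[U](\<lambda>_. 1)"
  show "(\<lambda>i. infnorm (E i)) \<in> o[U](\<lambda>_. 1)"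
  proof (rule landau_o.smallI)
    fix c :: real assume "c > 0"
    then have "\<forall>\<^sub>F i in U. \<bar>E i $ j\<bar> \<le> c" for j
      using landau_o.smallD[of "\<lambda>i. E i $ j" U "\<lambda>_. 1" c] E by simp
    then have "\<forall>\<^sub>F i in U. \<forall>j. \<bar>E i $ j\<bar> \<le> c" by (intro eventually_all_finite) auto
    then show "\<forall>\<^sub>F i in U. norm (infnorm (E i)) \<le> c * norm (1::real)"
    proof eventually_elim
      case (elim i)
      then have "infnorm (E i) \<le> c" unfolding infnorm_cart by (intro cSup_least) auto
      then show ?case by (simp add: infnorm_pos_le)
    qed
  qed
qed

lemma is_perp_hvec_iff:
  "is_perp U \<Theta> (hvec U N) m \<longleftrightarrow> (\<exists>M. (\<forall>i j. M i $ j \<in> \<int>) \<and> m = hvec U M \<and>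
     (\<lambda>i. infnorm (\<Theta> *v N i - M i)) \<in> o[U](\<lambda>_. 1))"
proof -
  have "hmat_vec U \<Theta> (hvec U N) $ k \<ominus>\<^bsub>hyperreal U\<^esub> hvec U M $ k =
      cls (\<lambda>i. (\<Theta> *v N i - M i) $ k)" for M k
    unfolding hmat_vec_hvec by (simp add: hvec_def minus_cls)
  then have "(\<forall>k. hmat_vec U \<Theta> (hvec U N) $ k \<ominus>\<^bsub>hyperreal U\<^esub> hvec U M $ k \<in> hinfinitesimal U)
      \<longleftrightarrow> (\<lambda>i. infnorm (\<Theta> *v N i - M i)) \<in> o[U](\<lambda>_. 1)" for M
    by (simp only: hinfinitesimal_cls infnorm_smallo_iff)
  then show ?thesis
    unfolding is_perp_def all_conj_distrib hyperint_vec_iff by blast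
qed

text \<open>Two integer vectors infinitesimally close to the same vector agree, since distinct
  integers are at least 1 apart. This justifies the definite description in
  \<open>herr\<close>.\<close>

lemma is_perp_unique:
  assumes "is_perp U \<Theta> (hvec U N) m" "is_perp U \<Theta> (hvec U N) m'"
  shows "m = m'"
proof -
  obtain M M' where M: "\<forall>i j. M i $ j \<in> \<int>" "m = hvec U M"
      "(\<lambda>i. infnorm (\<Theta> *v N i - M i)) \<in> o[U](\<lambda>_. 1)"
    and M': "\<forall>i j. M' i $ j \<in> \<int>" "m' = hvec U M'"
      "(\<lambda>i. infnorm (\<Theta> *v N i - M' i)) \<in> o[U](\<lambda>_. 1)"
    using assms unfolding is_perp_hvec_iff by blast
  \<comment> \<open>Any bound below 1/2 works: the two errors must add up to less than 1.\<close>
  have "\<forall>\<^sub>F i in U. infnorm (\<Theta> *v N i - M i) \<le> 1 / 3"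
       "\<forall>\<^sub>F i in U. infnorm (\<Theta> *v N i - M' i) \<le> 1 / 3"
    using landau_o.smallD[OF M(3), of "1/3"] landau_o.smallD[OF M'(3), of "1/3"]
    by (simp_all add: infnorm_pos_le)
  then have "\<forall>\<^sub>F i in U. M i = M' i"
  proof eventually_elim
    case (elim i)
    have "M i $ j = M' i $ j" for j
    proof -
      have "\<bar>(\<Theta> *v N i - M i) $ j\<bar> \<le> 1/3" "\<bar>(\<Theta> *v N i - M' i) $ j\<bar> \<le> 1/3"
        using elim component_le_infnorm_cart order_trans by blast+
      then have "\<bar>M i $ j - M' i $ j\<bar> < 1" unfolding vector_minus_component by linarith
      then show ?thesis using M(1) M'(1) Ints_nonzero_abs_less1[of "M i $ j - M' i $ j"] by auto
    qed
    then show ?case by (simp add: vec_eq_iff)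
  qed
  then show ?thesis using M M' by (simp add: hvec_eq_iff)
qed

lemma herr_hvec:
  assumes "\<forall>i j. M i $ j \<in> \<int>" "(\<lambda>i. infnorm (\<Theta> *v N i - M i)) \<in> o[U](\<lambda>_. 1)"
  shows "herr U \<Theta> (hvec U N) = hvec U (\<lambda>i. \<Theta> *v N i - M i)"
proof -
  have "is_perp U \<Theta> (hvec U N) (hvec U M)" using assms is_perp_hvec_iff by blast
  then have "(THE m. is_perp U \<Theta> (hvec U N) m) = hvec U M"
    using is_perp_unique by (intro the_equality)
  then show ?thesis by (simp add: herr_def hmat_vec_hvec) (simp add: hvec_def minus_cls)
qed

text \<open>\<open>N\<close> represents a nonzero element of \<open>hdioph U \<Theta>\<close> and
  \<open>M\<close> its integer part \<open>n^perp\<close>. Integrality is imposed at every index, so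
  that single terms are genuine integer vectors.\<close>

definition approximation ::
  "real ^ 's ^ 'r \<Rightarrow> (nat \<Rightarrow> real ^ 's) \<Rightarrow> (nat \<Rightarrow> real ^ 'r) \<Rightarrow> bool" where
  "approximation \<Theta> N M \<longleftrightarrow> (\<forall>i j. N i $ j \<in> \<int>) \<and> (\<forall>i j. M i $ j \<in> \<int>) \<and>
     (\<forall>\<^sub>F i in U. N i \<noteq> 0) \<and> (\<lambda>i. infnorm (\<Theta> *v N i - M i)) \<in> o[U](\<lambda>_. 1)"

lemma nonzero_hdioph_iff:
  "n \<in> hdioph U \<Theta> \<and> n \<noteq> hzero_vec U \<longleftrightarrow> (\<exists>N M. approximation \<Theta> N M \<and> n = hvec U N)"
proof
  assume n: "n \<in> hdioph U \<Theta> \<and> n \<noteq> hzero_vec U"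
  then obtain N where N: "\<forall>i j. N i $ j \<in> \<int>" "n = hvec U N"
    by (auto simp: hdioph_def hyperint_vec_iff)
  with n obtain M where M: "\<forall>i j. M i $ j \<in> \<int>"
    "(\<lambda>i. infnorm (\<Theta> *v N i - M i)) \<in> o[U](\<lambda>_. 1)"
    by (auto simp: hdioph_def is_perp_hvec_iff)
  have "\<forall>\<^sub>F i in U. N i \<noteq> 0"
    using n N by (simp add: hzero_vec_eq hvec_eq_iff eventually_not_iff)
  with N M show "\<exists>N M. approximation \<Theta> N M \<and> n = hvec U N"
    unfolding approximation_def by blast
next
  assume "\<exists>N M. approximation \<Theta> N M \<and> n = hvec U N"
  then obtain N M where N: "approximation \<Theta> N M" "n = hvec U N" by blast
  then have "n \<in> hdioph U \<Theta>"
    unfolding hdioph_def approximation_def mem_Collect_eq hyperint_vec_iff N(2) is_perp_hvec_iff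
    by blast
  moreover have "n \<noteq> hzero_vec U"
    using N by (simp add: approximation_def hzero_vec_eq hvec_eq_iff eventually_not_iff)
  ultimately show "n \<in> hdioph U \<Theta> \<and> n \<noteq> hzero_vec U" by blast
qed

lemma badly_approximable_iff:
  fixes \<Theta> :: "real ^ 's ^ 'r"
  shows "badly_approximable U \<Theta> \<longleftrightarrow> (\<exists>C>0. \<forall>N M. approximation \<Theta> N M \<longrightarrow>
     (\<forall>\<^sub>F i in U. C < infnorm (N i) ^ CARD('s) * infnorm (\<Theta> *v N i - M i) ^ CARD('r)))"
proof -
  let ?P = "\<lambda>C n. hless U (hconst U C)
             ((hmax U n [^]\<^bsub>hyperreal U\<^esub> CARD('s)) \<otimes>\<^bsub>hyperreal U\<^esub>
              (hmax U (herr U \<Theta> n) [^]\<^bsub>hyperreal U\<^esub> CARD('r)))"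
  let ?Q = "\<lambda>C N M. \<forall>\<^sub>F i in U. C < infnorm (N i) ^ CARD('s) * infnorm (\<Theta> *v N i - M i) ^ CARD('r)"
  have "?P C (hvec U N) \<longleftrightarrow> ?Q C N M" if "approximation \<Theta> N M" for C N M
  proof -
    have "herr U \<Theta> (hvec U N) = hvec U (\<lambda>i. \<Theta> *v N i - M i)"
      using that by (simp add: approximation_def herr_hvec)
    then show ?thesis by (simp add: hmax_hvec pow_cls hyperreal_simps hless_cls)
  qed
  moreover have "badly_approximable U \<Theta> \<longleftrightarrow>
      (\<exists>C>0. \<forall>n. n \<in> hdioph U \<Theta> \<and> n \<noteq> hzero_vec U \<longrightarrow> ?P C n)"
    by (auto simp: badly_approximable_def)
  ultimately show ?thesis unfolding nonzero_hdioph_iff by blast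
qed

text \<open>Irrationality enters here: \<open>\<Theta> *v N i = M i\<close> with \<open>N i\<close>
  nonzero would make \<open>\<Theta>\<close> rational. Positive errors keep all classes away from
  the class of zero.\<close>

lemma approximation_pos:
  assumes "\<not> rational_matrix \<Theta>" "approximation \<Theta> N M"
  shows "\<forall>\<^sub>F i in U. 0 < infnorm (N i)" "\<forall>\<^sub>F i in U. 0 < infnorm (\<Theta> *v N i - M i)"
proof -
  have N: "\<forall>\<^sub>F i in U. N i \<noteq> 0" using assms(2) by (simp add: approximation_def)
  then show "\<forall>\<^sub>F i in U. 0 < infnorm (N i)" by (simp add: infnorm_pos_lt)
  from N show "\<forall>\<^sub>F i in U. 0 < infnorm (\<Theta> *v N i - M i)"
  proof eventually_elim
    case (elim i)
    have "\<Theta> *v N i \<noteq> M i"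
      using elim assms unfolding rational_matrix_def approximation_def by metis
    then show ?case by (simp add: infnorm_pos_lt)
  qed
qed

text \<open>Reduces membership in the spectrum to Landau estimates on integer sequences; all later
  arguments about the spectrum go through this form.\<close>

lemma Spec_gcls_iff:
  fixes \<Theta> :: "real ^ 's ^ 'r"
  assumes irr: "\<not> rational_matrix \<Theta>"
    and X: "\<forall>\<^sub>F i in U. 0 < X i" "X \<in> o[U](\<lambda>_. 1)" and Y: "\<forall>\<^sub>F i in U. 0 < Y i" "Y \<in> o[U](\<lambda>_. 1)"
  shows "(gcls X, gcls Y) \<in> Spec U \<Theta> \<longleftrightarrow> (\<exists>N M. approximation \<Theta> N M \<and>
     (\<lambda>i. X i powr (1 / real CARD('s))) \<in> o[U](\<lambda>i. inverse (infnorm (N i))) \<and>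
     (\<lambda>i. infnorm (\<Theta> *v N i - M i)) \<in> O[U](\<lambda>i. Y i powr (1 / real CARD('r))))"
proof -
  let ?P = "\<lambda>n. growth_less U (growth_powr U (gcls X) (1 / real CARD('s)))
                      (inv\<^bsub>growth U\<^esub> (growth_class U (hmax U n))) \<and>
        growth_le U (growth_class U (hmax U (herr U \<Theta> n)))
                    (growth_powr U (gcls Y) (1 / real CARD('r)))"
  let ?Q = "\<lambda>N M. (\<lambda>i. X i powr (1 / real CARD('s))) \<in> o[U](\<lambda>i. inverse (infnorm (N i))) \<and>
     (\<lambda>i. infnorm (\<Theta> *v N i - M i)) \<in> O[U](\<lambda>i. Y i powr (1 / real CARD('r)))"
  have PQ: "?P (hvec U N) \<longleftrightarrow> ?Q N M" if NM: "approximation \<Theta> N M" for N M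
  proof -
    note pos = approximation_pos[OF irr NM]
    have powr: "\<forall>\<^sub>F i in U. 0 < X i powr t" "\<forall>\<^sub>F i in U. 0 < Y i powr t" for t
      using X(1) Y(1) by (eventually_elim, simp)+
    have inv: "\<forall>\<^sub>F i in U. 0 < inverse (infnorm (N i))"
      using pos(1) by (auto elim: eventually_mono)
    have "herr U \<Theta> (hvec U N) = hvec U (\<lambda>i. \<Theta> *v N i - M i)"
      using NM by (simp add: approximation_def herr_hvec)
    then show ?thesis
      by (simp only: hmax_hvec growth_powr_gcls[OF X(1)] growth_powr_gcls[OF Y(1)]
          growth_inv_gcls[OF pos(1)] growth_less_iff[OF powr(1) inv] growth_le_iff[OF pos(2) powr(2)])
  qed
  have "gcls X \<in> growth_inf U" "gcls Y \<in> growth_inf U"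
    using X Y by (auto simp: growth_inf_iff)
  then have "(gcls X, gcls Y) \<in> Spec U \<Theta> \<longleftrightarrow>
      (\<exists>n. (n \<in> hdioph U \<Theta> \<and> n \<noteq> hzero_vec U) \<and> ?P n)"
    by (auto simp: Spec_def hdioph_filt_def)
  then show ?thesis unfolding nonzero_hdioph_iff using PQ by blast
qed

section \<open>The spectrum and bad approximability\<close>

lemma powr_inverse_power_bigtheta:
  assumes X: "\<forall>\<^sub>F i in U. 0 < X i" and k: "k > 0"
  shows "(\<lambda>i. (X i powr (1 / real k)) ^ k) \<in> \<Theta>[U](X)"
proof (rule bigthetaI_cong)
  show "\<forall>\<^sub>F i in U. (X i powr (1 / real k)) ^ k = X i"
    using X
  proof eventually_elim
    case (elim i)
    have "(X i powr (1 / real k)) ^ k = (X i powr (1 / real k)) powr real k"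
      using elim by (subst powr_realpow) auto
    also have "\<dots> = X i" using elim k by (simp add: powr_powr)
    finally show ?case .
  qed
qed

text \<open>With size \<open>p\<close> and error \<open>e\<close>, the chain is
  \<open>X = o(p^-s)\<close>, \<open>p^-s = O(e^r)\<close>, \<open>e^r = O(Y)\<close>. The middle
  link is bad approximability, and the outer ones are powers of the two spectrum conditions.\<close>

lemma Spec_imp_growth_less:
  fixes \<Theta> :: "real ^ 's ^ 'r"
  assumes irr: "\<not> rational_matrix \<Theta>" and bad: "badly_approximable U \<Theta>"
    and X: "\<forall>\<^sub>F i in U. 0 < X i" "X \<in> o[U](\<lambda>_. 1)" and Y: "\<forall>\<^sub>F i in U. 0 < Y i" "Y \<in> o[U](\<lambda>_. 1)"
    and spec: "(gcls X, gcls Y) \<in> Spec U \<Theta>"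
  shows "X \<in> o[U](Y)"
proof -
  let ?s = "CARD('s)" and ?r = "CARD('r)"
  obtain N M where NM: "approximation \<Theta> N M"
    and N: "(\<lambda>i. X i powr (1 / real ?s)) \<in> o[U](\<lambda>i. inverse (infnorm (N i)))"
    and M: "(\<lambda>i. infnorm (\<Theta> *v N i - M i)) \<in> O[U](\<lambda>i. Y i powr (1 / real ?r))"
    using spec unfolding Spec_gcls_iff[OF irr X Y] by blast
  define p where "p = (\<lambda>i. infnorm (N i))"
  define e where "e = (\<lambda>i. infnorm (\<Theta> *v N i - M i))"
  obtain C where C: "C > 0" "\<forall>\<^sub>F i in U. C < p i ^ ?s * e i ^ ?r"
    using bad NM unfolding badly_approximable_iff p_def e_def by blast
  have p: "\<forall>\<^sub>F i in U. 0 < p i" and e: "\<forall>\<^sub>F i in U. 0 < e i"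
    using approximation_pos[OF irr NM] by (simp_all add: p_def e_def)
  have "X \<in> \<Theta>[U](\<lambda>i. (X i powr (1 / real ?s)) ^ ?s)"
    by (rule bigtheta_sym[THEN iffD1, OF powr_inverse_power_bigtheta[OF X(1)]]) simp
  also have "(\<lambda>i. (X i powr (1 / real ?s)) ^ ?s) \<in> o[U](\<lambda>i. inverse (p i) ^ ?s)"
    using N unfolding p_def by (rule landau_o.small_power) simp
  also have "(\<lambda>i. inverse (p i) ^ ?s) \<in> O[U](\<lambda>i. e i ^ ?r)"
  proof (rule bigoI)
    show "\<forall>\<^sub>F i in U. norm (inverse (p i) ^ ?s) \<le> (1 / C) * norm (e i ^ ?r)"
      using C(2) p e
    proof eventually_elim
      case (elim i)
      then have "C * inverse (p i) ^ ?s \<le> p i ^ ?s * e i ^ ?r * inverse (p i) ^ ?s"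
        by (intro mult_right_mono) auto
      also have "\<dots> = e i ^ ?r"
        using elim by (simp add: power_inverse)
      finally have "C * inverse (p i) ^ ?s \<le> e i ^ ?r" .
      then have "inverse (p i) ^ ?s \<le> e i ^ ?r / C"
        using C(1) by (simp only: pos_le_divide_eq mult.commute)
      then show ?case using elim by simp
    qed
  qed
  also have "(\<lambda>i. e i ^ ?r) \<in> O[U](\<lambda>i. (Y i powr (1 / real ?r)) ^ ?r)"
    using M unfolding e_def by (rule landau_o.big_power)
  also have "(\<lambda>i. (Y i powr (1 / real ?r)) ^ ?r) \<in> \<Theta>[U](Y)"
    by (rule powr_inverse_power_bigtheta[OF Y(1)]) simp
  finally show ?thesis .
qed

text \<open>Dirichlet at height \<open>Q = Y^(-1/s)\<close> gives error at most
  \<open>2 * Y^(1/r)\<close>, which is the condition on \<open>Y\<close>. The size is at most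
  \<open>Q\<close>, so its inverse is at least \<open>Y^(1/s)\<close>, which dominates
  \<open>X^(1/s)\<close>.\<close>

lemma growth_less_imp_Spec:
  fixes \<Theta> :: "real ^ 's ^ 'r"
  assumes irr: "\<not> rational_matrix \<Theta>"
    and X: "\<forall>\<^sub>F i in U. 0 < X i" "X \<in> o[U](\<lambda>_. 1)" and Y: "\<forall>\<^sub>F i in U. 0 < Y i" "Y \<in> o[U](\<lambda>_. 1)"
    and XY: "X \<in> o[U](Y)"
  shows "(gcls X, gcls Y) \<in> Spec U \<Theta>"
proof -
  let ?s = "CARD('s)" and ?r = "CARD('r)"
  \<comment> \<open>The maximum with 1 makes Dirichlet applicable at every index. It changes nothing
    where \<open>0 < Y i \<le> 1\<close>, hence nothing on a set of \<open>U\<close>.\<close>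
  define Q where "Q = (\<lambda>i. max 1 (Y i powr (- (1 / real ?s))))"
  have "\<forall>i. \<exists>n m. n \<noteq> 0 \<and> (\<forall>j. n $ j \<in> \<int>) \<and> (\<forall>j. m $ j \<in> \<int>) \<and> infnorm n \<le> Q i \<and>
     infnorm (\<Theta> *v n - m) \<le> 2 * Q i powr (- (real ?s / real ?r))"
    by (intro allI dirichlet_simultaneous) (simp add: Q_def)
  from this[THEN choice] obtain N where
    "\<forall>i. \<exists>m. N i \<noteq> 0 \<and> (\<forall>j. N i $ j \<in> \<int>) \<and> (\<forall>j. m $ j \<in> \<int>) \<and> infnorm (N i) \<le> Q i \<and>
     infnorm (\<Theta> *v N i - m) \<le> 2 * Q i powr (- (real ?s / real ?r))" ..
  from this[THEN choice] obtain M where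
    "\<forall>i. N i \<noteq> 0 \<and> (\<forall>j. N i $ j \<in> \<int>) \<and> (\<forall>j. M i $ j \<in> \<int>) \<and> infnorm (N i) \<le> Q i \<and>
     infnorm (\<Theta> *v N i - M i) \<le> 2 * Q i powr (- (real ?s / real ?r))" ..
  then have N: "\<And>i. N i \<noteq> 0" "\<And>i j. N i $ j \<in> \<int>" "\<And>i. infnorm (N i) \<le> Q i"
    and M: "\<And>i j. M i $ j \<in> \<int>"
      "\<And>i. infnorm (\<Theta> *v N i - M i) \<le> 2 * Q i powr (- (real ?s / real ?r))"
    by blast+
  have "\<forall>\<^sub>F i in U. norm (Y i) \<le> 1 * norm (1::real)"
    using landau_o.smallD[OF Y(2), of 1] by simp
  then have Q: "\<forall>\<^sub>F i in U. Q i = Y i powr (- (1 / real ?s))"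
    using Y(1)
  proof eventually_elim
    case (elim i)
    then have "Y i powr (1 / real ?s) \<le> 1" by (intro powr_le1) auto
    then show ?case using elim by (simp add: Q_def powr_minus one_le_inverse)
  qed
  have err: "(\<lambda>i. infnorm (\<Theta> *v N i - M i)) \<in> O[U](\<lambda>i. Y i powr (1 / real ?r))"
  proof (rule bigoI)
    show "\<forall>\<^sub>F i in U. norm (infnorm (\<Theta> *v N i - M i)) \<le> 2 * norm (Y i powr (1 / real ?r))"
      using Q
    proof eventually_elim
      case (elim i)
      then have "Q i powr (- (real ?s / real ?r)) = Y i powr (1 / real ?r)"
        by (simp add: powr_powr)
      then show ?case using M(2)[of i] by (simp add: infnorm_pos_le)
    qed
  qed
  \<comment> \<open>Since \<open>Y\<close> is infinitesimal so is its root; thus the errors are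
    infinitesimal, as \<open>approximation\<close> demands.\<close>
  also have "(\<lambda>i. Y i powr (1 / real ?r)) \<in> o[U](\<lambda>_. 1 powr (1 / real ?r))"
  proof (rule smallo_powr_nonneg[OF Y(2)])
    show "\<forall>\<^sub>F i in U. 0 \<le> Y i" using Y(1) by eventually_elim simp
  qed simp_all
  finally have "approximation \<Theta> N M"
    using N M by (simp add: approximation_def)
  moreover have "(\<lambda>i. X i powr (1 / real ?s)) \<in> o[U](\<lambda>i. inverse (infnorm (N i)))"
  proof -
    have "(\<lambda>i. X i powr (1 / real ?s)) \<in> o[U](\<lambda>i. Y i powr (1 / real ?s))"
    proof (rule smallo_powr_nonneg[OF XY])
      show "\<forall>\<^sub>F i in U. 0 \<le> X i" using X(1) by eventually_elim simp
      show "\<forall>\<^sub>F i in U. 0 \<le> Y i" using Y(1) by eventually_elim simp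
    qed simp
    also have "(\<lambda>i. Y i powr (1 / real ?s)) \<in> O[U](\<lambda>i. inverse (infnorm (N i)))"
    proof (rule bigoI)
      show "\<forall>\<^sub>F i in U. norm (Y i powr (1 / real ?s)) \<le> 1 * norm (inverse (infnorm (N i)))"
        using Q
      proof eventually_elim
        case (elim i)
        have "0 < infnorm (N i)" using N(1) by (simp add: infnorm_pos_lt)
        then have "inverse (Q i) \<le> inverse (infnorm (N i))"
          using N(3) by (intro le_imp_inverse_le)
        moreover have "inverse (Q i) = Y i powr (1 / real ?s)"
          using elim by (simp add: powr_minus)
        ultimately show ?case using \<open>0 < infnorm (N i)\<close> by simp
      qed
    qed
    finally show ?thesis .
  qed
  ultimately show ?thesis unfolding Spec_gcls_iff[OF irr X Y] using err by blast
qed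

text \<open>
  Replaces an appeal to saturation: the \<open>k\<close>-th term is one standard coordinate of a hyperinteger
  vector witnessing that the constant \<open>1 / (k + 1)\<close> fails.
\<close>

lemma not_badly_approximable_sequence:
  fixes \<Theta> :: "real ^ 's ^ 'r"
  assumes "\<not> badly_approximable U \<Theta>"
  obtains N M where "approximation \<Theta> N M"
    "(\<lambda>i. infnorm (N i) ^ CARD('s) * infnorm (\<Theta> *v N i - M i) ^ CARD('r)) \<in> o[U](\<lambda>_. 1)"
proof -
  let ?p = "\<lambda>n m. infnorm n ^ CARD('s) * infnorm (\<Theta> *v n - m) ^ CARD('r)"
  \<comment> \<open>Both quantities are bounded at once: the error, so that the diagonal sequence is
    again an approximation, and the product, so that it becomes infinitesimal.\<close>
  have "\<exists>n m. n \<noteq> 0 \<and> (\<forall>j. n $ j \<in> \<int>) \<and> (\<forall>j. m $ j \<in> \<int>) \<and>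
      infnorm (\<Theta> *v n - m) \<le> 1 / real (Suc k) \<and> ?p n m \<le> 1 / real (Suc k)" for k
  proof -
    let ?C = "1 / real (Suc k)"
    have C: "?C > 0" by simp
    then obtain N M where NM: "approximation \<Theta> N M" "\<not> (\<forall>\<^sub>F i in U. ?C < ?p (N i) (M i))"
      using assms unfolding badly_approximable_iff by blast
    have "\<forall>\<^sub>F i in U. ?p (N i) (M i) \<le> ?C"
      using NM(2) unfolding eventually_not_iff[symmetric] not_less .
    moreover have "\<forall>\<^sub>F i in U. infnorm (\<Theta> *v N i - M i) \<le> ?C"
      using NM(1) C landau_o.smallD[of "\<lambda>i. infnorm (\<Theta> *v N i - M i)" U "\<lambda>_. 1" ?C]
      by (simp add: approximation_def infnorm_pos_le del: of_nat_Suc)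
    moreover have "\<forall>\<^sub>F i in U. N i \<noteq> 0" using NM(1) by (simp add: approximation_def)
    ultimately have "\<forall>\<^sub>F i in U. N i \<noteq> 0 \<and> infnorm (\<Theta> *v N i - M i) \<le> ?C \<and> ?p (N i) (M i) \<le> ?C"
      by eventually_elim blast
    \<comment> \<open>A set of \<open>U\<close> is nonempty, so one index satisfies all three
      conditions and supplies ordinary integer vectors.\<close>
    then obtain i where "N i \<noteq> 0" "infnorm (\<Theta> *v N i - M i) \<le> ?C" "?p (N i) (M i) \<le> ?C"
      using eventually_happens'[OF nontrivial] by blast
    then show ?thesis using NM(1) unfolding approximation_def by blast
  qed
  then obtain N M where N: "\<And>k. N k \<noteq> 0" "\<And>k j. N k $ j \<in> \<int>" and M: "\<And>k j. M k $ j \<in> \<int>"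
    and e: "\<And>k. infnorm (\<Theta> *v N k - M k) \<le> 1 / real (Suc k)"
    and p: "\<And>k. ?p (N k) (M k) \<le> 1 / real (Suc k)"
    by metis
  have "(\<lambda>k. 1 / real (Suc k)) \<in> o(\<lambda>_. 1)"
    using LIMSEQ_inverse_real_of_nat by (intro smalloI_tendsto) (simp_all add: inverse_eq_divide)
  then have small: "(\<lambda>k. 1 / real (Suc k)) \<in> o[U](\<lambda>_. 1)"
    using le_sequentially landau_o.small.filter_mono by blast
  have *: "f \<in> o[U](\<lambda>_. 1)" if "\<And>k. 0 \<le> f k" "\<And>k. f k \<le> 1 / real (Suc k)" for f :: "nat \<Rightarrow> real"
  proof -
    have "f \<in> O[U](\<lambda>k. 1 / real (Suc k))"
      using that by (intro bigoI[of _ 1]) (simp del: of_nat_Suc)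
    then show ?thesis using small by (rule landau_o.big_small_trans)
  qed
  have "approximation \<Theta> N M"
    unfolding approximation_def using N M *[OF infnorm_pos_le e] by simp
  moreover have "(\<lambda>k. ?p (N k) (M k)) \<in> o[U](\<lambda>_. 1)"
    using p by (intro *) (simp_all add: infnorm_pos_le)
  ultimately show thesis by (rule that)
qed

text \<open>For \<open>X = e^r\<close> the error condition holds with equality,
  \<open>e = X^(1/r)\<close>. The size condition is the \<open>s\<close>-th root of the statement
  that \<open>p^s e^r\<close> is infinitesimal.\<close>

lemma not_badly_approximable_imp_Spec_flat:
  fixes \<Theta> :: "real ^ 's ^ 'r"
  assumes irr: "\<not> rational_matrix \<Theta>" and "\<not> badly_approximable U \<Theta>"
  shows "Spec_flat U \<Theta> \<noteq> {}"
proof -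
  let ?s = "CARD('s)" and ?r = "CARD('r)"
  obtain N M where NM: "approximation \<Theta> N M"
    and prod: "(\<lambda>i. infnorm (N i) ^ ?s * infnorm (\<Theta> *v N i - M i) ^ ?r) \<in> o[U](\<lambda>_. 1)"
    using not_badly_approximable_sequence[OF assms(2)] .
  define p where "p = (\<lambda>i. infnorm (N i))"
  define e where "e = (\<lambda>i. infnorm (\<Theta> *v N i - M i))"
  define X where "X = (\<lambda>i. e i ^ ?r)"
  have p: "\<forall>\<^sub>F i in U. 0 < p i" and e: "\<forall>\<^sub>F i in U. 0 < e i"
    using approximation_pos[OF irr NM] by (simp_all add: p_def e_def)
  have X: "\<forall>\<^sub>F i in U. 0 < X i" using e by eventually_elim (simp add: X_def)
  have "e \<in> o[U](\<lambda>_. 1)" using NM by (simp add: approximation_def e_def)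
  from landau_o.small_power[OF this, of ?r] have X1: "X \<in> o[U](\<lambda>_. 1)" by (simp add: X_def)
  have "(\<lambda>i. X i powr (1 / real ?s)) \<in> o[U](\<lambda>i. inverse (p i))"
  proof -
    \<comment> \<open>Rewrites \<open>e^(r/s)\<close> as \<open>(p^s e^r)^(1/s) / p\<close>,
      exposing the infinitesimal factor.\<close>
    have "(\<lambda>i. X i powr (1 / real ?s)) \<in> \<Theta>[U](\<lambda>i. (p i ^ ?s * e i ^ ?r) powr (1 / real ?s) * inverse (p i))"
    proof (rule bigthetaI_cong)
      show "\<forall>\<^sub>F i in U. X i powr (1 / real ?s) = (p i ^ ?s * e i ^ ?r) powr (1 / real ?s) * inverse (p i)"
        using p e
      proof eventually_elim
        case (elim i)
        then have "(p i ^ ?s) powr (1 / real ?s) = p i"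
          by (simp add: powr_powr flip: powr_realpow)
        then show ?case using elim by (simp add: powr_mult X_def)
      qed
    qed
    also have "(\<lambda>i. (p i ^ ?s * e i ^ ?r) powr (1 / real ?s) * inverse (p i)) \<in>
        o[U](\<lambda>i. 1 powr (1 / real ?s) * inverse (p i))"
      using prod unfolding p_def e_def
      by (intro landau_o.small_big_mult smallo_powr_nonneg) (simp_all add: infnorm_pos_le)
    finally show ?thesis by simp
  qed
  moreover have "e \<in> O[U](\<lambda>i. X i powr (1 / real ?r))"
  proof (rule bigthetaD1[OF bigthetaI_cong])
    show "\<forall>\<^sub>F i in U. e i = X i powr (1 / real ?r)"
      using e by eventually_elim (simp add: X_def powr_powr flip: powr_realpow)
  qed
  ultimately have "(gcls X, gcls X) \<in> Spec U \<Theta>"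
    unfolding Spec_gcls_iff[OF irr X X1 X X1] using NM unfolding p_def e_def by blast
  then show ?thesis unfolding Spec_flat_def by blast
qed

end

section \<open>The equivalence, as a cycle of implications\<close>

theorem theorem26:
  fixes U :: "nat filter" and \<Theta> :: "real ^ 's ^ 'r"
  assumes "nonprincipal_ultrafilter U"
    and "\<not> rational_matrix \<Theta>"
  shows "(badly_approximable U \<Theta> \<longleftrightarrow>
            Spec U \<Theta> = {(\<mu>, \<nu>). \<mu> \<in> growth_inf U \<and> \<nu> \<in> growth_inf U \<and> growth_less U \<mu> \<nu>})
       \<and> (Spec U \<Theta> = {(\<mu>, \<nu>). \<mu> \<in> growth_inf U \<and> \<nu> \<in> growth_inf U \<and> growth_less U \<mu> \<nu>} \<longleftrightarrow>
            Spec_flat U \<Theta> = {})"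
proof -
  interpret ultrapower U by (rule ultrapower.intro) (rule assms(1))
  let ?S = "{(\<mu>, \<nu>). \<mu> \<in> growth_inf U \<and> \<nu> \<in> growth_inf U \<and> growth_less U \<mu> \<nu>}"
  have ab: "Spec U \<Theta> = ?S" if bad: "badly_approximable U \<Theta>"
  proof -
    have "(\<mu>, \<nu>) \<in> Spec U \<Theta> \<longleftrightarrow> growth_less U \<mu> \<nu>"
      if \<mu>: "\<mu> \<in> growth_inf U" and \<nu>: "\<nu> \<in> growth_inf U" for \<mu> \<nu>
    proof -
      from \<mu> obtain X where X: "\<forall>\<^sub>F i in U. 0 < X i" "X \<in> o[U](\<lambda>_. 1)" "\<mu> = gcls X"
        unfolding growth_inf_iff by blast
      from \<nu> obtain Y where Y: "\<forall>\<^sub>F i in U. 0 < Y i" "Y \<in> o[U](\<lambda>_. 1)" "\<nu> = gcls Y"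
        unfolding growth_inf_iff by blast
      show ?thesis
        unfolding X(3) Y(3) growth_less_iff[OF X(1) Y(1)]
        using Spec_imp_growth_less[OF assms(2) bad X(1,2) Y(1,2)]
          growth_less_imp_Spec[OF assms(2) X(1,2) Y(1,2)] by blast
    qed
    moreover have "Spec U \<Theta> \<subseteq> growth_inf U \<times> growth_inf U" unfolding Spec_def by blast
    ultimately show ?thesis by blast
  qed
  have bc: "Spec_flat U \<Theta> = {}" if "Spec U \<Theta> = ?S"
  proof -
    \<comment> \<open>\<open>growth_less\<close> compares all pairs of representatives, so a class
      below itself would have a representative strictly below itself.\<close>
    have "\<not> growth_less U \<mu> \<mu>" if "\<mu> \<in> growth_inf U" for \<mu>
    proof
      assume less: "growth_less U \<mu> \<mu>"
      from that obtain X where X: "\<forall>\<^sub>F i in U. 0 < X i" "\<mu> = gcls X"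
        unfolding growth_inf_iff by blast
      then have "cls X \<in> \<mu>" by (simp add: growth_class_self)
      then have "\<forall>\<^sub>F i in U. X i < X i" using less unfolding growth_less_def hless_cls[symmetric] by blast
      then show False using nontrivial by simp
    qed
    with \<open>Spec U \<Theta> = ?S\<close> show ?thesis unfolding Spec_flat_def by blast
  qed
  have ca: "badly_approximable U \<Theta>" if "Spec_flat U \<Theta> = {}"
    using not_badly_approximable_imp_Spec_flat[OF assms(2)] that by blast
  show ?thesis using ab bc ca by blast
qed

end
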